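(* Let $\frac n2+\frac12<\alpha<\frac n2+1$ and let $$\mathbf{W}_\alpha(t,x)=\int_{\mathbb{R}_+\times\mathbf{H}^n}\mathbf{1}_{[0,t]}(r)\,\big(G_\alpha(x,q)-G_\alpha(e,q)\big)\,dW_{\mathbf{H}^n}(r,q),\qquad t\ge0,\ x\in\mathbf{H}^n.$$ Then for any $x\in\mathbf{H}^n$, any $t\in\mathbb{R}_+$ and any $z\in\mathbf{H}^n$, $$\{\mathbf{W}_\alpha(t,L_xy)-\mathbf{W}_\alpha(t,L_xz);\ y\in\mathbf{H}^n\}\stackrel{\mathcal{D}}{=}\{\mathbf{W}_\alpha(t,y)-\mathbf{W}_\alpha(t,z);\ y\in\mathbf{H}^n\}.$$
   Context: Let $n\ge1$. The Heisenberg group $\mathbf{H}^n$ is $\mathbb{R}^n\times\mathbb{R}^n\times\mathbb{R}$ with product $(x,y,z)\star(x',y',z')=(x+x',y+y',z+z'+2\sum_{i=1}^n(x_i'y_i-x_iy_i'))$ and identity $e=(0,0,0)$; $\mu$ is Lebesgue measure on $\mathbb{R}^{2n+1}$. Let $X_i=\partial_{x_i}+2y_i\partial_z$, $Y_i=\partial_{y_i}-2x_i\partial_z$ and $\Delta=\sum_{i=1}^n(X_i^2+Y_i^2)$ (self-adjoint on $L^2(\mathbf{H}^n,\mu)$). For $0<\alpha<n+1$, $G_\alpha(q_1,q_2)=\frac{1}{\Gamma(\alpha)}\int_0^\infty t^{\alpha-1}h_t(q_1^{-1}q_2)\,dt$ is the integral kernel of $(-\Delta)^{-\alpha}$, where $h_t(q_1^{-1}q_2)$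 is the kernel (w.r.t. $\mu$) of $e^{t\Delta}$. For $\frac{n+1}2<\alpha<\frac n2+1$, $G_\alpha(x,\cdot)-G_\alpha(e,\cdot)\in L^2(\mathbf{H}^n,\mu)$ for every $x\in\mathbf{H}^n$. $W_{\mathbf{H}^n}$ is a white noise on $\mathbb{R}_+\times\mathbf{H}^n$, i.e. a centered Gaussian family indexed by $L^2(\mathbb{R}_+\times\mathbf{H}^n;dt\otimes\mu)$ with covariance $\int_{\mathbb{R}_+\times\mathbf{H}^n}f\,g\,d\mu\,dt$. $L_xy=x\star y$ is the left translation. $\stackrel{\mathcal{D}}{=}$ denotes equality in law of processes. *)

theory Defs
  imports "HOL-Probability.Probability"
begin

section \<open>The Heisenberg group\<close>

text \<open>The dimension \<open>n\<close> is \<open>CARD('n)\<close>, and \<open>\<mu>\<close> is \<^term>\<open>lborel\<close> on the Euclidean space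
  \<open>'n heis\<close> of dimension \<open>2 * CARD('n) + 1\<close>.\<close>

type_synonym 'n heis = "(real ^ 'n) \<times> (real ^ 'n) \<times> real"

fun heis_mult :: "'n::finite heis \<Rightarrow> 'n heis \<Rightarrow> 'n heis" (infixl "\<star>" 70) where
  "(x, y, z) \<star> (x', y', z') =
     (x + x', y + y', z + z' + 2 * (\<Sum>i\<in>UNIV. x' $ i * y $ i - x $ i * y' $ i))"

definition heis_unit :: "'n::finite heis" where
  "heis_unit = (0, 0, 0)"

fun heis_inv :: "'n::finite heis \<Rightarrow> 'n heis" where
  "heis_inv (x, y, z) = (- x, - y, - z)"

lemma heis_assoc: "(p \<star> q) \<star> r = p \<star> (q \<star> r)"
  by (cases p; cases q; cases r)
    (simp add: sum_subtractf sum.distrib algebra_simps)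

lemma heis_unit_left [simp]: "heis_unit \<star> q = q"
  and heis_unit_right [simp]: "q \<star> heis_unit = q"
  by (cases q; simp add: heis_unit_def)+

lemma heis_inv_left [simp]: "heis_inv q \<star> q = heis_unit"
  and heis_inv_right [simp]: "q \<star> heis_inv q = heis_unit"
  by (cases q; simp add: heis_unit_def mult.commute)+


section \<open>The sub-Laplacian\<close>

definition vfX :: "'n::finite \<Rightarrow> ('n heis \<Rightarrow> real) \<Rightarrow> 'n heis \<Rightarrow> real" where
  "vfX i f = (\<lambda>(x, y, z).
     frechet_derivative f (at (x, y, z)) (axis i 1, 0, 0)
       + 2 * y $ i * frechet_derivative f (at (x, y, z)) (0, 0, 1))"

definition vfY :: "'n::finite \<Rightarrow> ('n heis \<Rightarrow> real) \<Rightarrow> 'n heis \<Rightarrow> real" where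
  "vfY i f = (\<lambda>(x, y, z).
     frechet_derivative f (at (x, y, z)) (0, axis i 1, 0)
       - 2 * x $ i * frechet_derivative f (at (x, y, z)) (0, 0, 1))"

definition sublaplacian :: "('n::finite heis \<Rightarrow> real) \<Rightarrow> 'n heis \<Rightarrow> real" where
  "sublaplacian f q = (\<Sum>i\<in>UNIV. vfX i (vfX i f) q + vfY i (vfY i f) q)"

primrec C_k :: "nat \<Rightarrow> ('a::euclidean_space \<Rightarrow> real) \<Rightarrow> bool" where
  "C_k 0 f \<longleftrightarrow> continuous_on UNIV f"
| "C_k (Suc k) f \<longleftrightarrow>
     f differentiable_on UNIV \<and> (\<forall>v. C_k k (\<lambda>q. frechet_derivative f (at q) v))"

definition test_function :: "('a::euclidean_space \<Rightarrow> real) \<Rightarrow> bool" where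
  "test_function f \<longleftrightarrow> (\<forall>k. C_k k f) \<and> compact (closure {q. f q \<noteq> 0})"


section \<open>Square-integrable functions and the heat semigroup\<close>

text \<open>Elements of \<open>L\<^sup>2\<close> are represented by functions, not by classes modulo null sets.\<close>

definition L2 :: "'a measure \<Rightarrow> ('a \<Rightarrow> real) set" where
  "L2 M = {f \<in> borel_measurable M. integrable M (\<lambda>x. (f x)\<^sup>2)}"

definition L2_dist :: "'a measure \<Rightarrow> ('a \<Rightarrow> real) \<Rightarrow> ('a \<Rightarrow> real) \<Rightarrow> real" where
  "L2_dist M f g = sqrt (\<integral>x. (f x - g x)\<^sup>2 \<partial>M)"

text \<open>The sub-Laplacian is essentially self-adjoint on the test functions; the self-adjoint
  operator meant by \<open>\<Delta>\<close> is the closure.  \<open>sublaplacian_graph f g\<close> says that \<open>f\<close> is in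
  its domain and that \<open>\<Delta> f = g\<close>.\<close>

definition sublaplacian_graph :: "('n::finite heis \<Rightarrow> real) \<Rightarrow> ('n heis \<Rightarrow> real) \<Rightarrow> bool" where
  "sublaplacian_graph f g \<longleftrightarrow> f \<in> L2 lborel \<and> g \<in> L2 lborel \<and>
     (\<exists>\<phi> :: nat \<Rightarrow> 'n heis \<Rightarrow> real. (\<forall>k. test_function (\<phi> k)) \<and>
        (\<lambda>k. L2_dist lborel (\<phi> k) f) \<longlonglongrightarrow> 0 \<and>
        (\<lambda>k. L2_dist lborel (sublaplacian (\<phi> k)) g) \<longlonglongrightarrow> 0)"

text \<open>\<open>P t = e\<^bsup>t\<Delta>\<^esup>\<close>: the strongly continuous semigroup of bounded linear operators on
  \<open>L\<^sup>2\<close> whose infinitesimal generator is exactly the self-adjoint operator \<open>\<Delta>\<close>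
  (same domain, same values).\<close>

definition heat_semigroup ::
    "(real \<Rightarrow> ('n::finite heis \<Rightarrow> real) \<Rightarrow> ('n heis \<Rightarrow> real)) \<Rightarrow> bool" where
  "heat_semigroup P \<longleftrightarrow>
     (\<forall>t\<ge>0. \<forall>f\<in>L2 lborel. P t f \<in> L2 lborel) \<and>
     (\<forall>t\<ge>0. \<forall>f\<in>L2 lborel. \<forall>g\<in>L2 lborel. \<forall>a b.
        AE q in lborel. P t (\<lambda>p. a * f p + b * g p) q = a * P t f q + b * P t g q) \<and>
     (\<forall>t\<ge>0. \<exists>C. \<forall>f\<in>L2 lborel.
        L2_dist lborel (P t f) (\<lambda>_. 0) \<le> C * L2_dist lborel f (\<lambda>_. 0)) \<and>
     (\<forall>f\<in>L2 lborel. AE q in lborel. P 0 f q = f q) \<and>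
     (\<forall>s\<ge>0. \<forall>t\<ge>0. \<forall>f\<in>L2 lborel. AE q in lborel. P (s + t) f q = P s (P t f) q) \<and>
     (\<forall>f\<in>L2 lborel. ((\<lambda>t. L2_dist lborel (P t f) f) \<longlongrightarrow> 0) (at_right 0)) \<and>
     (\<forall>f\<in>L2 lborel. \<forall>g\<in>L2 lborel.
        ((\<lambda>t. L2_dist lborel (\<lambda>q. (P t f q - f q) / t) g) \<longlongrightarrow> 0) (at_right 0)
          \<longleftrightarrow> sublaplacian_graph f g)"

text \<open>\<open>h t (q\<^sub>1\<inverse> q\<^sub>2)\<close> is the integral kernel of \<open>e\<^bsup>t\<Delta>\<^esup>\<close>.  A kernel is
  determined only almost everywhere; as usual the continuous version is taken, and this makes
  \<open>h t\<close> unique for \<open>t > 0\<close>.\<close>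

definition heat_kernel :: "(real \<Rightarrow> 'n::finite heis \<Rightarrow> real) \<Rightarrow> bool" where
  "heat_kernel h \<longleftrightarrow>
     continuous_on ({0<..} \<times> UNIV) (\<lambda>(t, q). h t q) \<and>
     (\<exists>P. heat_semigroup P \<and>
        (\<forall>t>0. \<forall>f\<in>L2 lborel. AE q\<^sub>1 in lborel.
           integrable lborel (\<lambda>q\<^sub>2. h t (heis_inv q\<^sub>1 \<star> q\<^sub>2) * f q\<^sub>2) \<and>
           P t f q\<^sub>1 = (\<integral>q\<^sub>2. h t (heis_inv q\<^sub>1 \<star> q\<^sub>2) * f q\<^sub>2 \<partial>lborel)))"

definition G_kernel ::
    "(real \<Rightarrow> 'n::finite heis \<Rightarrow> real) \<Rightarrow> real \<Rightarrow> 'n heis \<Rightarrow> 'n heis \<Rightarrow> real" where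
  "G_kernel h \<alpha> q\<^sub>1 q\<^sub>2 =
     1 / Gamma \<alpha> * (LINT t:{0<..}|lborel. t powr (\<alpha> - 1) * h t (heis_inv q\<^sub>1 \<star> q\<^sub>2))"


section \<open>White noise and the fractional field\<close>

text \<open>Centered Gaussian real random variables, the degenerate one (\<open>\<sigma> = 0\<close>) included.\<close>

definition centered_gaussian :: "'w measure \<Rightarrow> ('w \<Rightarrow> real) \<Rightarrow> bool" where
  "centered_gaussian M X \<longleftrightarrow> X \<in> borel_measurable M \<and>
     (\<exists>\<sigma>. distr M borel X = distr std_normal_distribution borel (\<lambda>u. \<sigma> * u))"

definition centered_gaussian_family ::
    "'w measure \<Rightarrow> 'i set \<Rightarrow> ('i \<Rightarrow> 'w \<Rightarrow> real) \<Rightarrow> bool" where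
  "centered_gaussian_family M I X \<longleftrightarrow>
     (\<forall>J c. finite J \<and> J \<subseteq> I \<longrightarrow> centered_gaussian M (\<lambda>\<omega>. \<Sum>j\<in>J. c j * X j \<omega>))"

definition time_space :: "(real \<times> 'n::finite heis) measure" where
  "time_space = restrict_space lborel {0..} \<Otimes>\<^sub>M lborel"

text \<open>\<open>W f\<close> is the stochastic integral \<open>\<integral> f dW\<close>.\<close>

definition white_noise ::
    "'w measure \<Rightarrow> ((real \<times> 'n::finite heis \<Rightarrow> real) \<Rightarrow> 'w \<Rightarrow> real) \<Rightarrow> bool" where
  "white_noise M W \<longleftrightarrow>
     centered_gaussian_family M (L2 time_space) W \<and>
     (\<forall>f\<in>L2 time_space. \<forall>g\<in>L2 time_space.
        (\<integral>\<omega>. W f \<omega> * W g \<omega> \<partial>M) = (\<integral>p. f p * g p \<partial>time_space))"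

definition W_field ::
    "((real \<times> 'n::finite heis \<Rightarrow> real) \<Rightarrow> 'w \<Rightarrow> real) \<Rightarrow> (real \<Rightarrow> 'n heis \<Rightarrow> real) \<Rightarrow> real
      \<Rightarrow> real \<Rightarrow> 'n heis \<Rightarrow> 'w \<Rightarrow> real" where
  "W_field W h \<alpha> t x =
     W (\<lambda>(r, q). indicator {0..t} r * (G_kernel h \<alpha> x q - G_kernel h \<alpha> heis_unit q))"

text \<open>Equality in law of two real processes with the same index set: their laws on the product
  \<open>\<sigma>\<close>-algebra coincide.\<close>

definition same_law ::
    "'w measure \<Rightarrow> ('i \<Rightarrow> 'w \<Rightarrow> real) \<Rightarrow> ('i \<Rightarrow> 'w \<Rightarrow> real) \<Rightarrow> bool" where
  "same_law M X Y \<longleftrightarrow>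
     (\<forall>i. X i \<in> borel_measurable M) \<and> (\<forall>i. Y i \<in> borel_measurable M) \<and>
     distr M (\<Pi>\<^sub>M i\<in>UNIV. borel) (\<lambda>\<omega> i. X i \<omega>) = distr M (\<Pi>\<^sub>M i\<in>UNIV. borel) (\<lambda>\<omega> i. Y i \<omega>)"

end

theory Submission
  imports Defs
begin

text \<open>The kernel satisfies \<open>G(xp, xq) = G(p, q)\<close>, and left translations preserve Lebesgue
  measure.  Hence linear combinations of the increments \<open>W(xy) - W(xz)\<close> have the same
  variance as those of \<open>W(y) - W(z)\<close>, so, being centered Gaussian, the same law; by
  Cramer-Wold the two processes have the same law.\<close>

section \<open>Left invariance\<close>

lemma heis_inv_mult: "heis_inv (p \<star> q) = heis_inv q \<star> heis_inv p"
  by (cases p; cases q) (simp add: sum_subtractf algebra_simps)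

lemma heis_inv_mult_cancel: "heis_inv (x \<star> p) \<star> (x \<star> q) = heis_inv p \<star> q"
proof -
  have "heis_inv (x \<star> p) \<star> (x \<star> q) = heis_inv p \<star> ((heis_inv x \<star> x) \<star> q)"
    by (simp only: heis_inv_mult heis_assoc)
  then show ?thesis
    by simp
qed

text \<open>The kernel sees its two arguments only through the inverse of the first times the
  second, and a common left factor cancels there.\<close>

lemma G_kernel_left_invariant: "G_kernel h \<alpha> (x \<star> p) (x \<star> q) = G_kernel h \<alpha> p q"
  by (simp add: G_kernel_def heis_inv_mult_cancel)

section \<open>Invariance of Lebesgue measure under left translations\<close>

lemma nn_integral_lborel_plus:
  fixes f :: "'a::euclidean_space \<Rightarrow> ennreal"
  assumes "f \<in> borel_measurable borel"
  shows "(\<integral>\<^sup>+q. f (c + q) \<partial>lborel) = (\<integral>\<^sup>+q. f q \<partial>lborel)"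
proof -
  have "(\<integral>\<^sup>+q. f q \<partial>lborel) = (\<integral>\<^sup>+q. f q \<partial>distr lborel borel ((+) c))"
    by (simp add: lborel_distr_plus)
  then show ?thesis
    using assms by (simp add: nn_integral_distr)
qed

lemma measurable_heis_mult [measurable]:
  "(\<star>) x \<in> borel_measurable borel" for x :: "'n::finite heis"
proof (rule borel_measurable_continuous_onI)
  obtain a b c where x: "x = (a, b, c)"
    by (cases x)
  have "(\<star>) x = (\<lambda>q. (a + fst q, b + fst (snd q),
      c + snd (snd q) + 2 * (\<Sum>i\<in>UNIV. fst q $ i * b $ i - a $ i * fst (snd q) $ i)))"
    by (auto simp: x fun_eq_iff)
  then show "continuous_on UNIV ((\<star>) x)"
    by (auto intro!: continuous_intros)
qed

text \<open>A left translation is a Euclidean translation composed with a shear: the first two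
  components are shifted by constants, and the last one by an amount that depends only on those two.
  Tonelli, with the last component integrated innermost, reduces the claim to Euclidean translation
  invariance in each component.\<close>

lemma distr_lborel_heis_mult: "distr lborel borel ((\<star>) x) = lborel" for x :: "'n::finite heis"
proof (rule measure_eqI)
  fix A assume "A \<in> sets (distr lborel borel ((\<star>) x))"
  then have A [measurable]: "A \<in> sets borel"
    by simp
  obtain a b c where x: "x = (a, b, c)"
    by (cases x)
  let ?s = "\<lambda>u v. 2 * (\<Sum>i\<in>UNIV. u $ i * b $ i - a $ i * v $ i)"
  have fub: "(\<integral>\<^sup>+q. f q \<partial>lborel) = (\<integral>\<^sup>+u. \<integral>\<^sup>+v. \<integral>\<^sup>+w. f (u, v, w) \<partial>lborel \<partial>lborel \<partial>lborel)"
    if [measurable]: "f \<in> borel_measurable borel" for f :: "'n heis \<Rightarrow> ennreal"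
  proof -
    have "(\<integral>\<^sup>+q. f q \<partial>lborel) = (\<integral>\<^sup>+q. f q \<partial>(lborel \<Otimes>\<^sub>M lborel))"
      by (simp only: lborel_prod)
    also have "\<dots> = (\<integral>\<^sup>+u. \<integral>\<^sup>+p. f (u, p) \<partial>lborel \<partial>lborel)"
      by (rule lborel.nn_integral_fst[symmetric]) (simp add: lborel_prod)
    also have "\<dots> = (\<integral>\<^sup>+u. \<integral>\<^sup>+p. f (u, p) \<partial>(lborel \<Otimes>\<^sub>M lborel) \<partial>lborel)"
      by (simp only: lborel_prod)
    also have "\<dots> = (\<integral>\<^sup>+u. \<integral>\<^sup>+v. \<integral>\<^sup>+w. f (u, v, w) \<partial>lborel \<partial>lborel \<partial>lborel)"
      by (intro nn_integral_cong lborel.nn_integral_fst[symmetric]) (simp add: lborel_prod)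
    finally show ?thesis .
  qed
  have meas: "(\<lambda>w. indicator A (u, v, w) :: ennreal) \<in> borel_measurable borel" for u v
    by measurable
  have "emeasure (distr lborel borel ((\<star>) x)) A = (\<integral>\<^sup>+q. indicator A (x \<star> q) \<partial>lborel)"
    by (subst nn_integral_distr[symmetric, of "(\<star>) x" lborel borel]) (simp_all)
  also have "\<dots> = (\<integral>\<^sup>+u. \<integral>\<^sup>+v. \<integral>\<^sup>+w. indicator A (x \<star> (u, v, w)) \<partial>lborel \<partial>lborel \<partial>lborel)"
    by (rule fub) simp
  also have "\<dots> = (\<integral>\<^sup>+u. \<integral>\<^sup>+v. \<integral>\<^sup>+w. indicator A (a + u, b + v, (c + ?s u v) + w)
      \<partial>lborel \<partial>lborel \<partial>lborel)"
    by (simp add: x algebra_simps)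
  \<comment> \<open>For fixed \<open>u\<close> and \<open>v\<close> the shift
    \<open>c + ?s u v\<close> is a constant in the innermost integral, so the shear disappears. Only
    then are the constant shifts of \<open>v\<close> and of \<open>u\<close> removed.\<close>
  also have "\<dots> = (\<integral>\<^sup>+u. \<integral>\<^sup>+v. \<integral>\<^sup>+w. indicator A (a + u, b + v, w) \<partial>lborel \<partial>lborel \<partial>lborel)"
    by (subst nn_integral_lborel_plus[OF meas]) (rule refl)
  also have "\<dots> = (\<integral>\<^sup>+u. \<integral>\<^sup>+v. \<integral>\<^sup>+w. indicator A (a + u, v, w) \<partial>lborel \<partial>lborel \<partial>lborel)"
    by (intro nn_integral_cong nn_integral_lborel_plus[of "\<lambda>v. \<integral>\<^sup>+w. indicator A (_, v, w) \<partial>lborel"])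
      measurable
  also have "\<dots> = (\<integral>\<^sup>+u. \<integral>\<^sup>+v. \<integral>\<^sup>+w. indicator A (u, v, w) \<partial>lborel \<partial>lborel \<partial>lborel)"
    by (intro nn_integral_lborel_plus[of "\<lambda>u. \<integral>\<^sup>+v. \<integral>\<^sup>+w. indicator A (u, v, w) \<partial>lborel \<partial>lborel"])
      measurable
  also have "\<dots> = emeasure lborel A"
    by (subst fub[symmetric]) simp_all
  finally show "emeasure (distr lborel borel ((\<star>) x)) A = emeasure lborel A" .
qed simp

section \<open>The space-time measure and the integrands of the field\<close>

lemma sigma_finite_restrict_lborel: "sigma_finite_measure (restrict_space lborel {0::real..})"
  by (rule sigma_finite_measure_restrict_space) (simp_all add: sigma_finite_lborel)

lemma distr_time_space_heis_mult:
  "distr time_space time_space (\<lambda>(r, q). (r, x \<star> q)) = time_space" for x :: "'n::finite heis"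
proof -
  let ?R = "restrict_space lborel {0::real..}"
  \<comment> \<open>The target is \<open>lborel\<close> instead of \<open>borel\<close>, to fit the
    image of a product measure below; \<open>distr\<close> uses only the measurable sets of its
    target, which are the same.\<close>
  have L: "distr lborel lborel ((\<star>) x) = lborel"
    using distr_cong[of lborel lborel lborel borel "(\<star>) x" "(\<star>) x"]
    by (simp add: distr_lborel_heis_mult)
  have "distr ?R ?R (\<lambda>r. r) \<Otimes>\<^sub>M distr lborel lborel ((\<star>) x)
      = distr (?R \<Otimes>\<^sub>M lborel) (?R \<Otimes>\<^sub>M lborel) (\<lambda>(r, q). (r, x \<star> q))"
    by (intro pair_measure_distr) (simp_all add: L sigma_finite_lborel)
  then show ?thesis
    by (simp only: time_space_def distr_id L)
qed

text \<open>The time indicator is its own square and has finite integral because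
  \<open>{0..t}\<close> is bounded, so the square of the product is a tensor product of two
  integrable functions.\<close>

lemma L2_time_space_indicator_mult:
  fixes g :: "'n::finite heis \<Rightarrow> real"
  assumes "g \<in> L2 lborel"
  shows "(\<lambda>(r, q). indicator {0..t} r * g q) \<in> L2 time_space"
proof -
  let ?R = "restrict_space lborel {0::real..}"
  interpret R: sigma_finite_measure ?R
    by (rule sigma_finite_restrict_lborel)
  interpret pair_sigma_finite ?R "lborel :: 'n heis measure" ..
  have [measurable]: "g \<in> borel_measurable borel" and g2: "integrable lborel (\<lambda>q. (g q)\<^sup>2)"
    using assms by (auto simp: L2_def)
  have [measurable]: "(\<lambda>r. r) \<in> measurable ?R borel"
    by (simp add: measurable_restrict_space1)
  have I: "integrable ?R (indicator {0..t} :: real \<Rightarrow> real)"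
    by (subst integrable_restrict_space)
      (auto simp: indicator_inter_arith[symmetric] emeasure_lborel_Icc_eq intro!: integrable_real_indicator)
  have "integrable (?R \<Otimes>\<^sub>M lborel) (\<lambda>p. indicator {0..t} (fst p) * (g (snd p))\<^sup>2)"
    using I g2 by (intro Fubini_integrable) auto
  moreover have "(indicator {0..t} r)\<^sup>2 = (indicator {0..t} r :: real)" for r
    by (simp add: indicator_def)
  ultimately show ?thesis
    by (simp add: L2_def time_space_def split_beta power_mult_distrib)
qed

section \<open>Gaussian variables and white noise\<close>

lemma centered_gaussian_square_integrable:
  assumes "centered_gaussian M X"
  shows "integrable M (\<lambda>\<omega>. (X \<omega>)\<^sup>2)"
proof -
  obtain \<sigma> where X [measurable]: "X \<in> borel_measurable M"
    and d: "distr M borel X = distr std_normal_distribution borel (\<lambda>u. \<sigma> * u)"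
    using assms by (auto simp: centered_gaussian_def)
  have "integrable (distr std_normal_distribution borel (\<lambda>u. \<sigma> * u)) (\<lambda>x. x\<^sup>2)"
    using std_normal_distribution_even_moments(2)[of 1]
    by (subst integrable_distr_eq) (simp_all add: power_mult_distrib)
  then show ?thesis
    by (subst (asm) d[symmetric], subst (asm) integrable_distr_eq) simp_all
qed

text \<open>The variable has the law of \<open>\<sigma>\<close> times a standard normal one, whose
  second moment is 1. Hence \<open>\<sigma>\<close> squared is the second moment of
  \<open>X\<close>, and the characteristic function can be written without \<open>\<sigma>\<close>,
  which is determined only up to sign.\<close>

lemma centered_gaussian_char:
  assumes "centered_gaussian M X"
  shows "char (distr M borel X) s = exp (- (s\<^sup>2 * (\<integral>\<omega>. (X \<omega>)\<^sup>2 \<partial>M)) / 2)"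
proof -
  obtain \<sigma> where X [measurable]: "X \<in> borel_measurable M"
    and d: "distr M borel X = distr std_normal_distribution borel (\<lambda>u. \<sigma> * u)"
    using assms by (auto simp: centered_gaussian_def)
  have "(\<integral>\<omega>. (X \<omega>)\<^sup>2 \<partial>M) = (\<integral>x. x\<^sup>2 \<partial>distr M borel X)"
    by (simp add: integral_distr)
  also have "\<dots> = (\<integral>u. \<sigma>\<^sup>2 * u\<^sup>2 \<partial>std_normal_distribution)"
    by (simp add: d integral_distr power_mult_distrib)
  also have "\<dots> = \<sigma>\<^sup>2"
    using std_normal_distribution_even_moments(1)[of 1] by simp
  finally have "(\<integral>\<omega>. (X \<omega>)\<^sup>2 \<partial>M) = \<sigma>\<^sup>2" .
  moreover have "char (distr M borel X) s = char std_normal_distribution (\<sigma> * s)"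
    by (simp add: d char_def integral_distr mult_ac)
  ultimately show ?thesis
    by (simp add: char_std_normal_distribution power_mult_distrib mult_ac exp_of_real)
qed

text \<open>The characteristic function involves the variable only through its second moment, the
  degenerate case included, so Levy uniqueness applies.\<close>

lemma centered_gaussian_eq_law:
  assumes M: "prob_space M" and N: "prob_space N"
    and X: "centered_gaussian M X" and Y: "centered_gaussian N Y"
    and eq: "(\<integral>\<omega>. (X \<omega>)\<^sup>2 \<partial>M) = (\<integral>\<omega>. (Y \<omega>)\<^sup>2 \<partial>N)"
  shows "distr M borel X = distr N borel Y"
proof (rule Levy_uniqueness)
  show "real_distribution (distr M borel X)"
    using M X by (simp add: prob_space.real_distribution_distr centered_gaussian_def)
  show "real_distribution (distr N borel Y)"
    using N Y by (simp add: prob_space.real_distribution_distr centered_gaussian_def)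
  show "char (distr M borel X) = char (distr N borel Y)"
    by (simp add: fun_eq_iff centered_gaussian_char[OF X] centered_gaussian_char[OF Y] eq)
qed

lemma integrable_mult_L2:
  assumes "f \<in> L2 M" "g \<in> L2 M"
  shows "integrable M (\<lambda>x. f x * g x)"
proof (rule Bochner_Integration.integrable_bound)
  show "integrable M (\<lambda>x. (f x)\<^sup>2 + (g x)\<^sup>2)"
    using assms by (auto simp: L2_def)
  show "(\<lambda>x. f x * g x) \<in> borel_measurable M"
    using assms by (auto simp: L2_def)
  show "AE x in M. norm (f x * g x) \<le> norm ((f x)\<^sup>2 + (g x)\<^sup>2)"
  proof (rule AE_I2)
    fix x
    have "2 * \<bar>f x * g x\<bar> \<le> (f x)\<^sup>2 + (g x)\<^sup>2"
      using sum_squares_bound[of "\<bar>f x\<bar>" "\<bar>g x\<bar>"] by (simp add: abs_mult)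
    then show "norm (f x * g x) \<le> norm ((f x)\<^sup>2 + (g x)\<^sup>2)"
      by simp
  qed
qed

text \<open>The square expands into a quadratic form in the Gram matrix. It is used both over the
  probability space and over \<open>time_space\<close>, where the covariance identity matches the
  two matrices.\<close>

lemma integral_sum_square_L2:
  assumes "\<And>a. a \<in> A \<Longrightarrow> f a \<in> L2 M"
  shows "(\<integral>x. (\<Sum>a\<in>A. c a * f a x)\<^sup>2 \<partial>M)
    = (\<Sum>a\<in>A. \<Sum>b\<in>A. c a * c b * (\<integral>x. f a x * f b x \<partial>M))"
proof -
  have int: "integrable M (\<lambda>x. c a * c b * (f a x * f b x))" if "a \<in> A" "b \<in> A" for a b
    using assms that by (intro integrable_mult_right integrable_mult_L2)
  have "(\<Sum>a\<in>A. c a * f a x)\<^sup>2 = (\<Sum>a\<in>A. \<Sum>b\<in>A. c a * c b * (f a x * f b x))" for x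
    unfolding power2_eq_square sum_product by (simp only: mult_ac)
  then have "(\<integral>x. (\<Sum>a\<in>A. c a * f a x)\<^sup>2 \<partial>M)
      = (\<integral>x. (\<Sum>a\<in>A. \<Sum>b\<in>A. c a * c b * (f a x * f b x)) \<partial>M)"
    by simp
  also have "\<dots> = (\<Sum>a\<in>A. \<integral>x. (\<Sum>b\<in>A. c a * c b * (f a x * f b x)) \<partial>M)"
    by (intro Bochner_Integration.integral_sum Bochner_Integration.integrable_sum int)
  also have "\<dots> = (\<Sum>a\<in>A. \<Sum>b\<in>A. \<integral>x. c a * c b * (f a x * f b x) \<partial>M)"
    by (intro sum.cong refl Bochner_Integration.integral_sum int)
  finally show ?thesis
    by simp
qed

text \<open>The indexing function \<open>g\<close> need not be injective, whereas a Gaussian family is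
  indexed by the functions themselves, so coefficients of equal functions are collected.\<close>

lemma white_noise_gaussian:
  assumes W: "white_noise M W" and "finite A" and g: "\<And>a. a \<in> A \<Longrightarrow> g a \<in> L2 time_space"
  shows "centered_gaussian M (\<lambda>\<omega>. \<Sum>a\<in>A. c a * W (g a) \<omega>)"
proof -
  have "(\<Sum>a\<in>A. c a * W (g a) \<omega>) = (\<Sum>f\<in>g ` A. (\<Sum>a\<in>{a \<in> A. g a = f}. c a) * W f \<omega>)" for \<omega>
  proof -
    have "(\<Sum>a\<in>A. c a * W (g a) \<omega>) = (\<Sum>f\<in>g ` A. \<Sum>a\<in>{a \<in> A. g a = f}. c a * W (g a) \<omega>)"
      using \<open>finite A\<close> by (rule sum.image_gen)
    then show ?thesis
      by (simp add: sum_distrib_right)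
  qed
  moreover have "finite (g ` A)" "g ` A \<subseteq> L2 time_space"
    using \<open>finite A\<close> g by auto
  ultimately show ?thesis
    using W by (simp add: white_noise_def centered_gaussian_family_def)
qed

lemma white_noise_L2:
  assumes "white_noise M W" "f \<in> L2 time_space"
  shows "W f \<in> L2 M"
proof -
  have "centered_gaussian M (W f)"
    using white_noise_gaussian[OF assms(1), of "{()}" "\<lambda>_. f" "\<lambda>_. 1"] assms(2) by simp
  then show ?thesis
    using centered_gaussian_square_integrable by (auto simp: L2_def centered_gaussian_def)
qed

text \<open>Both sides are the same quadratic form in the covariances. The combination is one of
  values of \<open>W\<close>, so that no linearity of \<open>W\<close> in its index enters.\<close>

lemma white_noise_isometry:
  assumes W: "white_noise M W" and g: "\<And>a. a \<in> A \<Longrightarrow> g a \<in> L2 time_space"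
  shows "(\<integral>\<omega>. (\<Sum>a\<in>A. c a * W (g a) \<omega>)\<^sup>2 \<partial>M) = (\<integral>p. (\<Sum>a\<in>A. c a * g a p)\<^sup>2 \<partial>time_space)"
proof -
  have "(\<integral>\<omega>. W (g a) \<omega> * W (g b) \<omega> \<partial>M) = (\<integral>p. g a p * g b p \<partial>time_space)"
    if "a \<in> A" "b \<in> A" for a b
    using W g that by (simp add: white_noise_def)
  moreover have "W (g a) \<in> L2 M" if "a \<in> A" for a
    using white_noise_L2[OF W] g that by simp
  ultimately show ?thesis
    using g by (simp add: integral_sum_square_L2 cong: sum.cong)
qed

section \<open>The Cramer-Wold device\<close>

text \<open>The measures with densities \<open>w\<close> and \<open>w'\<close>, pushed forward by
  \<open>X\<close> and \<open>X'\<close>, have the same Fourier transform: phase 0 gives its real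
  part and phase -pi/2 its imaginary part. After normalization to mass 1 this is Levy uniqueness;
  zero mass is treated separately.\<close>

lemma weighted_Levy_uniqueness:
  fixes w X :: "'a \<Rightarrow> real" and w' X' :: "'b \<Rightarrow> real"
  assumes [measurable]: "X \<in> borel_measurable M" "X' \<in> borel_measurable M'" "B \<in> sets borel"
    and w: "integrable M w" "\<And>x. 0 \<le> w x" and w': "integrable M' w'" "\<And>x. 0 \<le> w' x"
    and eq: "\<And>s \<theta>. (\<integral>x. w x * cos (s * X x + \<theta>) \<partial>M) = (\<integral>x. w' x * cos (s * X' x + \<theta>) \<partial>M')"
  shows "(\<integral>x. w x * indicator B (X x) \<partial>M) = (\<integral>x. w' x * indicator B (X' x) \<partial>M')"
proof -
  \<comment> \<open>Frequency and phase 0 turn the cosine into 1.\<close>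
  have mass: "(\<integral>x. w x \<partial>M) = (\<integral>x. w' x \<partial>M')"
    using eq[of 0 0] by simp
  \<comment> \<open>Stated over an arbitrary measure space, because it serves for \<open>M\<close>
    and for \<open>M'\<close>, whose types may differ. \<open>D\<close> is the law of
    \<open>Z\<close> under the normalized weighted measure.\<close>
  have law: "\<exists>D. real_distribution D
        \<and> (\<forall>s. char D s = Complex ((\<integral>x. v x * cos (s * Z x + 0) \<partial>N) / integral\<^sup>L N v)
              ((\<integral>x. v x * cos (s * Z x + (- pi / 2)) \<partial>N) / integral\<^sup>L N v))
        \<and> (\<integral>x. v x * indicator B (Z x) \<partial>N) = integral\<^sup>L N v * measure D B"
    if [measurable]: "Z \<in> borel_measurable N" and v: "integrable N v" "\<And>x. 0 \<le> v x"
      and pos: "integral\<^sup>L N v > 0"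
    for N :: "'c measure" and v Z :: "'c \<Rightarrow> real"
  proof -
    let ?m = "integral\<^sup>L N v"
    let ?P = "density N (\<lambda>x. v x / ?m)"
    have [measurable]: "v \<in> borel_measurable N"
      using v by auto
    have "prob_space ?P"
    proof (rule prob_spaceI)
      have "emeasure ?P (space ?P) = (\<integral>\<^sup>+x. ennreal (v x / ?m) \<partial>N)"
        by (simp add: emeasure_density cong: nn_integral_cong)
      also have "\<dots> = ennreal (\<integral>x. v x / ?m \<partial>N)"
        using v pos by (intro nn_integral_eq_integral) auto
      finally show "emeasure ?P (space ?P) = 1"
        using pos by simp
    qed
    then have "real_distribution (distr ?P borel Z)"
      by (simp add: prob_space.real_distribution_distr)
    moreover have "char (distr ?P borel Z) s =
        Complex ((\<integral>x. v x * cos (s * Z x + 0) \<partial>N) / ?m)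
          ((\<integral>x. v x * cos (s * Z x + (- pi / 2)) \<partial>N) / ?m)" for s
    proof -
      let ?e = "\<lambda>x. (v x / ?m) *\<^sub>R iexp (s * Z x)"
      have int: "integrable N ?e"
        by (rule Bochner_Integration.integrable_bound[of _ "\<lambda>x. v x / ?m"])
          (use v in auto)
      have "char (distr ?P borel Z) s = (\<integral>x. ?e x \<partial>N)"
        using v pos by (simp add: char_def integral_distr integral_density)
      moreover have "Re (\<integral>x. ?e x \<partial>N) = (\<integral>x. v x * cos (s * Z x + 0) \<partial>N) / ?m"
        by (subst integral_Re[OF int, symmetric]) (simp add: Re_exp)
      \<comment> \<open>Shifting the cosine by -pi/2 gives the sine.\<close>
      moreover have "Im (\<integral>x. ?e x \<partial>N) = (\<integral>x. v x * cos (s * Z x + (- pi / 2)) \<partial>N) / ?m"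
        by (subst integral_Im[OF int, symmetric]) (simp add: Im_exp cos_diff)
      ultimately show ?thesis
        by (simp add: complex_eq_iff)
    qed
    moreover have "(\<integral>x. v x * indicator B (Z x) \<partial>N) = ?m * measure (distr ?P borel Z) B"
    proof -
      have "measure (distr ?P borel Z) B = (\<integral>x. indicator B x \<partial>distr ?P borel Z)"
        by simp
      also have "\<dots> = (\<integral>x. indicator B (Z x) \<partial>?P)"
        by (rule integral_distr) simp_all
      also have "\<dots> = (\<integral>x. v x / ?m * indicator B (Z x) \<partial>N)"
        using v pos by (subst integral_density) simp_all
      finally show ?thesis
        using pos by simp
    qed
    ultimately show ?thesis
      by blast
  qed
  show ?thesis
  proof (cases "(\<integral>x. w x \<partial>M) > 0")
    case True
    obtain D where D: "real_distribution D"
      "\<And>s. char D s = Complex ((\<integral>x. w x * cos (s * X x + 0) \<partial>M) / integral\<^sup>L M w)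
              ((\<integral>x. w x * cos (s * X x + (- pi / 2)) \<partial>M) / integral\<^sup>L M w)"
      "(\<integral>x. w x * indicator B (X x) \<partial>M) = integral\<^sup>L M w * measure D B"
      using law[OF assms(1) w True] by blast
    obtain D' where D': "real_distribution D'"
      "\<And>s. char D' s = Complex ((\<integral>x. w' x * cos (s * X' x + 0) \<partial>M') / integral\<^sup>L M' w')
              ((\<integral>x. w' x * cos (s * X' x + (- pi / 2)) \<partial>M') / integral\<^sup>L M' w')"
      "(\<integral>x. w' x * indicator B (X' x) \<partial>M') = integral\<^sup>L M' w' * measure D' B"
      using law[OF assms(2) w'] True mass by auto
    have "char D = char D'"
      by (simp only: fun_eq_iff D(2) D'(2) eq mass simp_thms)
    with D(1) D'(1) have "D = D'"
      by (rule Levy_uniqueness)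
    with D(3) D'(3) mass show ?thesis
      by simp
  next
    case False
    \<comment> \<open>A nonnegative weight without positive mass vanishes almost everywhere, so both
      sides of the claim are 0.\<close>
    have null: "(\<integral>x. v x * indicator B (Z x) \<partial>N) = 0"
      if v: "integrable N v" "\<And>x. 0 \<le> v x" and "\<not> integral\<^sup>L N v > 0"
      for N :: "'c measure" and v Z :: "'c \<Rightarrow> real"
    proof -
      have "0 \<le> integral\<^sup>L N v"
        using v(2) by (rule Bochner_Integration.integral_nonneg)
      then have "integral\<^sup>L N v = 0"
        using that(3) by linarith
      then have "AE x in N. v x = 0"
        using integral_nonneg_eq_0_iff_AE[of N v] v by simp
      then have "AE x in N. v x * indicator B (Z x) = 0"
        by eventually_elim simp
      then show ?thesis
        by (rule integral_eq_zero_AE)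
    qed
    show ?thesis
      using null[OF w False] null[OF w'] False mass by simp
  qed
qed

section \<open>Moments that mix indicators and cosines\<close>

lemma integrable_prod_indicator_mult_cos:
  fixes f :: "'a \<Rightarrow> real"
  assumes "finite_measure M" and [measurable]: "\<And>j. X j \<in> borel_measurable M"
    and [measurable]: "\<And>j. B j \<in> sets borel" "f \<in> borel_measurable M"
  shows "integrable M (\<lambda>\<omega>. (\<Prod>k\<in>K. indicator (B k) (X k \<omega>)) * cos (f \<omega>))"
proof -
  interpret finite_measure M by fact
  have "\<bar>(\<Prod>k\<in>K. indicator (B k) (X k \<omega>)) * cos (f \<omega>)\<bar> \<le> 1" for \<omega>
  proof -
    have "(\<Prod>k\<in>K. indicator (B k) (X k \<omega>) :: real) \<le> 1"
      by (rule prod_le_1) simp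
    then show ?thesis
      using mult_mono[of "\<bar>\<Prod>k\<in>K. indicator (B k) (X k \<omega>)\<bar>" 1 "\<bar>cos (f \<omega>)\<bar>" 1]
      by (simp add: abs_mult prod_nonneg)
  qed
  then show ?thesis
    by (intro integrable_const_bound[of _ 1]) simp_all
qed

text \<open>Interpolates between Fourier data and probabilities: with \<open>K\<close> empty it is
  the Fourier transform of the law of the vector indexed by \<open>J\<close>, and with
  \<open>c\<close> and \<open>\<theta>\<close> zero it is the measure of a cylinder with base in the
  coordinates \<open>K\<close>. The phase \<open>\<theta>\<close> lets real cosines carry the sines
  as well.\<close>

definition cos_moment ::
  "'a measure \<Rightarrow> ('i \<Rightarrow> 'a \<Rightarrow> real) \<Rightarrow> ('i \<Rightarrow> real set) \<Rightarrow> 'i set \<Rightarrow> 'i set \<Rightarrow> ('i \<Rightarrow> real) \<Rightarrow> real \<Rightarrow> real"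
  where "cos_moment M X B K J c \<theta> =
    (\<integral>\<omega>. (\<Prod>k\<in>K. indicator (B k) (X k \<omega>)) * cos ((\<Sum>j\<in>J. c j * X j \<omega>) + \<theta>) \<partial>M)"

text \<open>The product-to-sum formula for cosines absorbs the test factor
  \<open>cos (s * X k \<omega> + \<eta>)\<close> into the frequency of coordinate \<open>k\<close>
  and the phase. The left side thereby becomes a combination of moments with the same
  \<open>K\<close>, which an induction on \<open>K\<close> can compare.\<close>

lemma cos_moment_shift:
  fixes X :: "'i \<Rightarrow> 'a \<Rightarrow> real"
  assumes M: "finite_measure M" and X [measurable]: "\<And>j. X j \<in> borel_measurable M"
    and B [measurable]: "\<And>j. B j \<in> sets borel" and J: "finite J" "k \<in> J"
  shows "(\<integral>\<omega>. (\<Prod>k\<in>K. indicator (B k) (X k \<omega>)) * (1 + cos ((\<Sum>j\<in>J. c j * X j \<omega>) + \<theta>))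
        * cos (s * X k \<omega> + \<eta>) \<partial>M)
    = cos_moment M X B K J ((\<lambda>_. 0)(k := s)) \<eta>
      + (cos_moment M X B K J (c(k := c k + s)) (\<theta> + \<eta>)
          + cos_moment M X B K J (c(k := c k - s)) (\<theta> - \<eta>)) / 2"
proof -
  have upd: "(\<Sum>j\<in>J. (d(k := d k + r)) j * X j \<omega>) = (\<Sum>j\<in>J. d j * X j \<omega>) + r * X k \<omega>" for d r \<omega>
    using J by (simp add: sum.remove[of J k] algebra_simps)
  have upds:
    "(\<Sum>j\<in>J. ((\<lambda>_. 0)(k := s)) j * X j \<omega>) = s * X k \<omega>"
    "(\<Sum>j\<in>J. (c(k := c k + s)) j * X j \<omega>) = (\<Sum>j\<in>J. c j * X j \<omega>) + s * X k \<omega>"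
    "(\<Sum>j\<in>J. (c(k := c k - s)) j * X j \<omega>) = (\<Sum>j\<in>J. c j * X j \<omega>) - s * X k \<omega>" for \<omega>
    using upd[of "\<lambda>_. 0" s] upd[of c s] upd[of c "- s"] by simp_all
  have trig: "P * (1 + cos (a + \<theta>)) * cos (b + \<eta>)
      = P * cos (b + \<eta>) + (P * cos (a + b + (\<theta> + \<eta>)) + P * cos (a - b + (\<theta> - \<eta>))) / 2"
    for P a b :: real
  proof -
    have "cos (a + b + (\<theta> + \<eta>)) + cos (a - b + (\<theta> - \<eta>)) = 2 * (cos (a + \<theta>) * cos (b + \<eta>))"
      using cos_add[of "a + \<theta>" "b + \<eta>"] cos_diff[of "a + \<theta>" "b + \<eta>"]
      by (simp add: algebra_simps)
    then have "P * cos (a + b + (\<theta> + \<eta>)) + P * cos (a - b + (\<theta> - \<eta>))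
        = P * (2 * (cos (a + \<theta>) * cos (b + \<eta>)))"
      by (simp only: flip: distrib_left)
    then show ?thesis
      by (simp add: distrib_left distrib_right)
  qed
  have int: "integrable M (\<lambda>\<omega>. (\<Prod>k\<in>K. indicator (B k) (X k \<omega>)) * cos (f \<omega>))"
    if "f \<in> borel_measurable M" for f :: "'a \<Rightarrow> real"
    by (intro integrable_prod_indicator_mult_cos M X B that)
  have lin: "(\<integral>\<omega>. u \<omega> + (v \<omega> + w \<omega>) / 2 \<partial>M) = integral\<^sup>L M u + (integral\<^sup>L M v + integral\<^sup>L M w) / 2"
    if "integrable M u" "integrable M v" "integrable M w" for u v w :: "'a \<Rightarrow> real"
    using that by simp
  show ?thesis
    unfolding cos_moment_def upds trig
    by (intro lin int) measurable
qed

text \<open>Expanding \<open>1 + cos\<close> writes \<open>R c \<theta>\<close> as the mass of the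
  indicator product over \<open>insert k K\<close> plus the wanted moment. At zero frequencies and
  phase the cosine is 1, so \<open>R\<close> is twice that mass; this explains the factor
  1/2.\<close>

lemma cos_moment_insert:
  fixes X :: "'i \<Rightarrow> 'a \<Rightarrow> real" and J :: "'i set"
  assumes M: "finite_measure M" and X [measurable]: "\<And>j. X j \<in> borel_measurable M"
    and B [measurable]: "\<And>j. B j \<in> sets borel" and K: "finite K" "k \<notin> K"
  defines "R \<equiv> \<lambda>c \<theta>. \<integral>\<omega>. (\<Prod>k\<in>K. indicator (B k) (X k \<omega>))
    * (1 + cos ((\<Sum>j\<in>J. c j * X j \<omega>) + \<theta>)) * indicator (B k) (X k \<omega>) \<partial>M"
  shows "cos_moment M X B (insert k K) J c \<theta> = R c \<theta> - R (\<lambda>_. 0) 0 / 2"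
proof -
  let ?P = "\<lambda>\<omega>. \<Prod>k\<in>insert k K. indicator (B k) (X k \<omega>) :: real"
  have int: "integrable M (\<lambda>\<omega>. ?P \<omega> * cos ((\<Sum>j\<in>J. c j * X j \<omega>) + \<theta>))" for c \<theta>
    by (rule integrable_prod_indicator_mult_cos[OF M]) simp_all
  have int1: "integrable M ?P"
    using int[of "\<lambda>_. 0" 0] by simp
  have "R c \<theta> = (\<integral>\<omega>. ?P \<omega> + ?P \<omega> * cos ((\<Sum>j\<in>J. c j * X j \<omega>) + \<theta>) \<partial>M)" for c \<theta>
    unfolding R_def using K by (intro Bochner_Integration.integral_cong) (simp_all add: algebra_simps)
  then have "R c \<theta> = integral\<^sup>L M ?P + cos_moment M X B (insert k K) J c \<theta>" for c \<theta>
    unfolding cos_moment_def by (simp only: Bochner_Integration.integral_add[OF int1 int])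
  moreover have "cos_moment M X B (insert k K) J (\<lambda>_. 0) 0 = integral\<^sup>L M ?P"
    by (simp add: cos_moment_def)
  ultimately show ?thesis
    by simp
qed

text \<open>The frequencies are traded for indicators one coordinate at a time.  Adding \<open>1\<close> to
  the cosine makes it a nonnegative weight, to which the one-dimensional uniqueness theorem
  applies.\<close>

lemma cos_moment_eq:
  fixes X :: "'i \<Rightarrow> 'a \<Rightarrow> real" and Y :: "'i \<Rightarrow> 'b \<Rightarrow> real"
  assumes M: "prob_space M" and N: "prob_space N"
    and X [measurable]: "\<And>j. X j \<in> borel_measurable M"
    and Y [measurable]: "\<And>j. Y j \<in> borel_measurable N"
    and B [measurable]: "\<And>j. B j \<in> sets borel"
    and J: "finite J"
    and eq: "\<And>c. distr M borel (\<lambda>\<omega>. \<Sum>j\<in>J. c j * X j \<omega>) = distr N borel (\<lambda>\<omega>. \<Sum>j\<in>J. c j * Y j \<omega>)"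
    and "finite K" "K \<subseteq> J"
  shows "cos_moment M X B K J c \<theta> = cos_moment N Y B K J c \<theta>"
  using \<open>finite K\<close> \<open>K \<subseteq> J\<close>
proof (induction K arbitrary: c \<theta>)
  case empty
  \<comment> \<open>Without indicators the moment is an integral against the law of one linear
    combination, and these laws agree by \<open>eq\<close>.\<close>
  have "(\<integral>\<omega>. cos ((\<Sum>j\<in>J. c j * X j \<omega>) + \<theta>) \<partial>M)
      = (\<integral>x. cos (x + \<theta>) \<partial>distr M borel (\<lambda>\<omega>. \<Sum>j\<in>J. c j * X j \<omega>))"
    by (rule integral_distr[symmetric]) simp_all
  also have "\<dots> = (\<integral>\<omega>. cos ((\<Sum>j\<in>J. c j * Y j \<omega>) + \<theta>) \<partial>N)"
    unfolding eq by (rule integral_distr) simp_all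
  finally show ?case
    by (simp add: cos_moment_def)
next
  case (insert k K)
  then have k: "k \<in> J" and IH: "\<And>c \<theta>. cos_moment M X B K J c \<theta> = cos_moment N Y B K J c \<theta>"
    by auto
  interpret M: prob_space M by fact
  interpret N: prob_space N by fact
  note fin = M.finite_measure_axioms N.finite_measure_axioms
  \<comment> \<open>The constant term of the weight is the case of the zero function inside the
    cosine, as cos 0 = 1.\<close>
  have weight: "integrable L (\<lambda>\<omega>. (\<Prod>k\<in>K. indicator (B k) (Z k \<omega>)) * (1 + cos ((\<Sum>j\<in>J. c j * Z j \<omega>) + \<theta>)))"
    if L: "finite_measure L" and [measurable]: "\<And>j. Z j \<in> borel_measurable L"
    for L :: "'c measure" and Z :: "_ \<Rightarrow> 'c \<Rightarrow> real" and c \<theta>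
    using integrable_prod_indicator_mult_cos[OF L, of Z B "\<lambda>_. 0" K]
      integrable_prod_indicator_mult_cos[OF L, of Z B "\<lambda>\<omega>. (\<Sum>j\<in>J. c j * Z j \<omega>) + \<theta>" K]
    by (simp add: distrib_left)
  have nonneg: "0 \<le> (\<Prod>k\<in>K. indicator (B k) (v k)) * (1 + cos r)" for v and r :: real
  proof (rule mult_nonneg_nonneg)
    show "0 \<le> 1 + cos r"
      using cos_ge_minus_one[of r] by linarith
  qed (simp add: prod_nonneg)
  \<comment> \<open>The indicator of coordinate \<open>k\<close> is gained from
    \<open>weighted_Levy_uniqueness\<close> applied to \<open>X k\<close> and \<open>Y k\<close>.
    Its cosine hypothesis is rewritten by \<open>cos_moment_shift\<close> into moments for
    \<open>K\<close> with changed frequencies and phases, which is why the induction leaves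
    \<open>c\<close> and \<open>\<theta>\<close> arbitrary.\<close>
  have "(\<integral>\<omega>. (\<Prod>k\<in>K. indicator (B k) (X k \<omega>)) * (1 + cos ((\<Sum>j\<in>J. c j * X j \<omega>) + \<theta>))
        * indicator (B k) (X k \<omega>) \<partial>M)
      = (\<integral>\<omega>. (\<Prod>k\<in>K. indicator (B k) (Y k \<omega>)) * (1 + cos ((\<Sum>j\<in>J. c j * Y j \<omega>) + \<theta>))
        * indicator (B k) (Y k \<omega>) \<partial>N)" for c \<theta>
  proof (rule weighted_Levy_uniqueness)
    show "integrable M (\<lambda>\<omega>. (\<Prod>k\<in>K. indicator (B k) (X k \<omega>)) * (1 + cos ((\<Sum>j\<in>J. c j * X j \<omega>) + \<theta>)))"
      by (rule weight[OF fin(1) X])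
    show "integrable N (\<lambda>\<omega>. (\<Prod>k\<in>K. indicator (B k) (Y k \<omega>)) * (1 + cos ((\<Sum>j\<in>J. c j * Y j \<omega>) + \<theta>)))"
      by (rule weight[OF fin(2) Y])
  qed (simp_all only: X Y B nonneg cos_moment_shift[of M X B J k, OF fin(1) X B J k]
        cos_moment_shift[of N Y B J k, OF fin(2) Y B J k] IH)
  then show ?case
    by (simp only: cos_moment_insert[of M X B K k, OF fin(1) X B insert.hyps]
        cos_moment_insert[of N Y B K k, OF fin(2) Y B insert.hyps])
qed

text \<open>A finite measure on the product \<sigma>-algebra is determined by the cylinders over
  finite index sets, and the probability of such a cylinder is a \<open>cos_moment\<close> with
  \<open>K = J\<close> and zero frequencies and phase.\<close>

lemma same_law_if_linear_combinations:
  fixes X Y :: "'i \<Rightarrow> 'w \<Rightarrow> real"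
  assumes M: "prob_space M"
    and X [measurable]: "\<And>j. X j \<in> borel_measurable M"
    and Y [measurable]: "\<And>j. Y j \<in> borel_measurable M"
    and eq: "\<And>J c. finite J \<Longrightarrow>
      distr M borel (\<lambda>\<omega>. \<Sum>j\<in>J. c j * X j \<omega>) = distr M borel (\<lambda>\<omega>. \<Sum>j\<in>J. c j * Y j \<omega>)"
  shows "same_law M X Y"
proof -
  interpret prob_space M by fact
  let ?Pi = "\<Pi>\<^sub>M i\<in>(UNIV :: 'i set). (borel :: real measure)"
  have path [measurable]: "(\<lambda>\<omega> i. Z i \<omega>) \<in> measurable M ?Pi"
    if "\<And>j. Z j \<in> borel_measurable M" for Z :: "'i \<Rightarrow> 'w \<Rightarrow> real"
    using that by (intro measurable_PiM_single') (auto simp: PiE_def)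
  \<comment> \<open>The sets \<open>A\<close> are known to be Borel only on \<open>J\<close>,
    whereas \<open>cos_moment_eq\<close> asks for a Borel set at every index; hence the default
    value \<open>UNIV\<close> outside \<open>J\<close>.\<close>
  have cyl: "emeasure (distr M ?Pi (\<lambda>\<omega> i. Z i \<omega>)) (prod_emb UNIV (\<lambda>_. borel) J (Pi\<^sub>E J A))
      = ennreal (cos_moment M Z (\<lambda>j. if j \<in> J then A j else UNIV) J J (\<lambda>_. 0) 0)"
    if Z [measurable]: "\<And>j. Z j \<in> borel_measurable M" and J: "finite J"
      and A: "\<And>i. i \<in> J \<Longrightarrow> A i \<in> sets borel" for Z :: "'i \<Rightarrow> 'w \<Rightarrow> real" and J A
  proof -
    let ?E = "{\<omega> \<in> space M. \<forall>j\<in>J. Z j \<omega> \<in> A j}"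
    have "(\<lambda>\<omega> i. Z i \<omega>) -` prod_emb UNIV (\<lambda>_. borel) J (Pi\<^sub>E J A) \<inter> space M = ?E"
      by (auto simp: prod_emb_def PiE_iff)
    moreover have "prod_emb UNIV (\<lambda>_. borel) J (Pi\<^sub>E J A) \<in> sets ?Pi"
      using J A by (intro sets_PiM_I) auto
    moreover have "?E \<in> sets M"
    proof (rule sets.sets_Collect_finite_All[OF _ J])
      show "{\<omega> \<in> space M. Z j \<omega> \<in> A j} \<in> sets M" if "j \<in> J" for j
        using measurable_sets[OF Z A[OF that], of j] by (simp add: vimage_def Int_def conj_commute)
    qed
    moreover have "cos_moment M Z (\<lambda>j. if j \<in> J then A j else UNIV) J J (\<lambda>_. 0) 0
        = (\<integral>\<omega>. indicator ?E \<omega> \<partial>M)"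
      unfolding cos_moment_def
    proof (intro Bochner_Integration.integral_cong refl)
      fix \<omega> assume "\<omega> \<in> space M"
      have "(\<Prod>k\<in>J. indicator (if k \<in> J then A k else UNIV) (Z k \<omega>)) = (indicator ?E \<omega> :: real)"
      proof (cases "\<forall>j\<in>J. Z j \<omega> \<in> A j")
        case True
        with \<open>\<omega> \<in> space M\<close> show ?thesis
          by (simp add: prod.neutral)
      next
        case False
        with J have "(\<Prod>k\<in>J. indicator (if k \<in> J then A k else UNIV) (Z k \<omega>)) = (0 :: real)"
          by (intro prod_zero) (auto simp: indicator_def)
        with False show ?thesis
          by simp
      qed
      then show "(\<Prod>k\<in>J. indicator (if k \<in> J then A k else UNIV) (Z k \<omega>))
          * cos ((\<Sum>j\<in>J. 0 * Z j \<omega>) + 0) = (indicator ?E \<omega> :: real)"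
        by simp
    qed
    ultimately show ?thesis
      by (simp add: emeasure_distr path[OF Z] emeasure_eq_measure)
  qed
  have "distr M ?Pi (\<lambda>\<omega> i. X i \<omega>) = distr M ?Pi (\<lambda>\<omega> i. Y i \<omega>)"
  proof (rule measure_eqI_PiM_infinite)
    fix A :: "'i \<Rightarrow> real set" and J :: "'i set"
    assume J: "finite J" and A: "\<And>i. i \<in> J \<Longrightarrow> A i \<in> sets borel"
    let ?B = "\<lambda>j. if j \<in> J then A j else UNIV"
    have "cos_moment M X ?B J J (\<lambda>_. 0) 0 = cos_moment M Y ?B J J (\<lambda>_. 0) 0"
      using A by (intro cos_moment_eq M X Y J eq) auto
    then show "emeasure (distr M ?Pi (\<lambda>\<omega> i. X i \<omega>)) (prod_emb UNIV (\<lambda>_. borel) J (Pi\<^sub>E J A))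
        = emeasure (distr M ?Pi (\<lambda>\<omega> i. Y i \<omega>)) (prod_emb UNIV (\<lambda>_. borel) J (Pi\<^sub>E J A))"
      using cyl[of X J A] cyl[of Y J A] X Y J A by simp
  next
    show "finite_measure (distr M ?Pi (\<lambda>\<omega> i. X i \<omega>))"
      using path[OF X] by (rule finite_measure_distr)
  qed simp_all
  then show ?thesis
    by (simp add: same_law_def)
qed

section \<open>Left invariance of the increments of the field\<close>

theorem proposition3p15:
  fixes M :: "'w measure"
    and W :: "(real \<times> 'n::finite heis \<Rightarrow> real) \<Rightarrow> 'w \<Rightarrow> real"
    and h :: "real \<Rightarrow> 'n heis \<Rightarrow> real"
    and \<alpha> t :: real
    and x z :: "'n heis"
  assumes "prob_space M"
    and "white_noise M W"
    and "heat_kernel h"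
    and "real CARD('n) / 2 + 1 / 2 < \<alpha>" and "\<alpha> < real CARD('n) / 2 + 1"
    and "\<And>p. (\<lambda>q. G_kernel h \<alpha> p q - G_kernel h \<alpha> heis_unit q) \<in> L2 lborel"
    and "0 \<le> t"
  shows "same_law M
    (\<lambda>y \<omega>. W_field W h \<alpha> t (x \<star> y) \<omega> - W_field W h \<alpha> t (x \<star> z) \<omega>)
    (\<lambda>y \<omega>. W_field W h \<alpha> t y \<omega> - W_field W h \<alpha> t z \<omega>)"
proof (rule same_law_if_linear_combinations)
  note M = \<open>prob_space M\<close> and W = \<open>white_noise M W\<close>
  define g where "g p = (\<lambda>(r, q). indicator {0..t} r * (G_kernel h \<alpha> p q - G_kernel h \<alpha> heis_unit q))"
    for p :: "'n heis"
  have field: "W_field W h \<alpha> t p = W (g p)" for p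
    by (simp add: W_field_def g_def)
  have g: "g p \<in> L2 time_space" for p
    unfolding g_def by (rule L2_time_space_indicator_mult) fact
  have [measurable]: "W (g p) \<in> borel_measurable M" for p
    using white_noise_L2[OF W g] by (simp add: L2_def)
  show "(\<lambda>\<omega>. W_field W h \<alpha> t (x \<star> y) \<omega> - W_field W h \<alpha> t (x \<star> z) \<omega>) \<in> borel_measurable M" for y
    by (simp add: field)
  show "(\<lambda>\<omega>. W_field W h \<alpha> t y \<omega> - W_field W h \<alpha> t z \<omega>) \<in> borel_measurable M" for y
    by (simp add: field)
  fix J :: "'n heis set" and c :: "'n heis \<Rightarrow> real"
  assume J: "finite J"
  \<comment> \<open>A combination of differences is rewritten as one sum over
    \<open>J \<times> UNIV\<close> with a Boolean tag: \<open>True\<close> marks the term at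
    \<open>j\<close> with coefficient \<open>c j\<close>, \<open>False\<close> the term at
    \<open>z\<close> with the opposite coefficient. This is the form that the white noise lemmas
    accept.\<close>
  define d where "d = (\<lambda>(j, b). if b then c j else - c j)"
  have split: "(\<Sum>j\<in>J. c j * (v (f j) - v (f z)))
      = (\<Sum>a\<in>J \<times> UNIV. d a * v (f (if snd a then fst a else z)))"
    for v :: "'n heis \<Rightarrow> real" and f
  proof -
    have "(\<Sum>a\<in>J \<times> UNIV. d a * v (f (if snd a then fst a else z)))
        = (\<Sum>j\<in>J. \<Sum>b\<in>UNIV. d (j, b) * v (f (if b then j else z)))"
      by (subst sum.cartesian_product) (simp add: split_beta)
    also have "\<dots> = (\<Sum>j\<in>J. c j * (v (f j) - v (f z)))"
      by (simp add: d_def UNIV_bool right_diff_distrib)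
    finally show ?thesis ..
  qed
  \<comment> \<open>The map \<open>f\<close> is later the left translation by \<open>x\<close> or
    the identity, so both processes are treated at once.\<close>
  have gaussian: "centered_gaussian M (\<lambda>\<omega>. \<Sum>j\<in>J. c j * (W (g (f j)) \<omega> - W (g (f z)) \<omega>))"
    and variance: "(\<integral>\<omega>. (\<Sum>j\<in>J. c j * (W (g (f j)) \<omega> - W (g (f z)) \<omega>))\<^sup>2 \<partial>M)
      = (\<integral>p. (\<Sum>j\<in>J. c j * (g (f j) p - g (f z) p))\<^sup>2 \<partial>time_space)" for f
  proof -
    show "centered_gaussian M (\<lambda>\<omega>. \<Sum>j\<in>J. c j * (W (g (f j)) \<omega> - W (g (f z)) \<omega>))"
      unfolding split[of "\<lambda>p. W (g p) \<omega>" f for \<omega>] using J g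
      by (intro white_noise_gaussian[OF W]) simp_all
    show "(\<integral>\<omega>. (\<Sum>j\<in>J. c j * (W (g (f j)) \<omega> - W (g (f z)) \<omega>))\<^sup>2 \<partial>M)
      = (\<integral>p. (\<Sum>j\<in>J. c j * (g (f j) p - g (f z) p))\<^sup>2 \<partial>time_space)"
      unfolding split[of "\<lambda>p. W (g p) \<omega>" f for \<omega>] split[of "\<lambda>q. g q p" f for p] using g
      by (intro white_noise_isometry[OF W]) simp_all
  qed
  have [measurable]: "g p \<in> borel_measurable time_space" for p
    using g[of p] by (simp add: L2_def)
  have T: "(\<lambda>(r, q). (r, x \<star> q)) \<in> measurable time_space time_space"
    unfolding time_space_def by measurable
  \<comment> \<open>The terms based at \<open>heis_unit\<close> would not be carried along by the
    translation, but they cancel in the increment; left invariance of the kernel handles what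
    remains.\<close>
  have diff: "g (x \<star> y) (r, x \<star> q) - g (x \<star> z) (r, x \<star> q) = g y (r, q) - g z (r, q)" for y r q
    by (simp add: g_def G_kernel_left_invariant flip: right_diff_distrib)
  \<comment> \<open>Equality of the variances: the measure is replaced by its image under
    translation of the space variable, and the change of variables then lets \<open>diff\<close>
    remove \<open>x\<close>.\<close>
  have "(\<integral>p. (\<Sum>j\<in>J. c j * (g (x \<star> j) p - g (x \<star> z) p))\<^sup>2 \<partial>time_space)
      = (\<integral>p. (\<Sum>j\<in>J. c j * (g (x \<star> j) p - g (x \<star> z) p))\<^sup>2
          \<partial>distr time_space time_space (\<lambda>(r, q). (r, x \<star> q)))"
    by (simp add: distr_time_space_heis_mult)
  also have "\<dots> = (\<integral>p. (\<Sum>j\<in>J. c j * (g j p - g z p))\<^sup>2 \<partial>time_space)"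
    by (subst integral_distr[OF T]) (auto simp: diff split_beta intro!: Bochner_Integration.integral_cong)
  finally have "(\<integral>p. (\<Sum>j\<in>J. c j * (g (x \<star> j) p - g (x \<star> z) p))\<^sup>2 \<partial>time_space)
      = (\<integral>p. (\<Sum>j\<in>J. c j * (g j p - g z p))\<^sup>2 \<partial>time_space)" .
  then show "distr M borel (\<lambda>\<omega>. \<Sum>j\<in>J. c j * (W_field W h \<alpha> t (x \<star> j) \<omega> - W_field W h \<alpha> t (x \<star> z) \<omega>))
      = distr M borel (\<lambda>\<omega>. \<Sum>j\<in>J. c j * (W_field W h \<alpha> t j \<omega> - W_field W h \<alpha> t z \<omega>))"
    unfolding field
    by (intro centered_gaussian_eq_law[OF M M gaussian[of "(\<star>) x"] gaussian[of "\<lambda>y. y"]])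
      (simp only: variance[of "(\<star>) x"] variance[of "\<lambda>y. y"])
qed (fact \<open>prob_space M\<close>)

end
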